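(* Let $X,Y$ be sets and let $a$ be a partial function from $Y$ to $X$ with $1\leq\alpha=\operatorname{rank}(a)=|Y|<|X|<\aleph_0$. Then $\operatorname{rank}(\mathcal{PT}_{XY}^a)=S(|X|+1,\alpha+1)$.
   Context: Maps are written on the right and composed left to right. $\mathcal{PT}_{XY}$ is the set of all partial functions $X\to Y$; $\mathcal{PT}_{XY}^a$ is the sandwich semigroup $(\mathcal{PT}_{XY},\star_a)$ with $f\star_ag=fag$. For a partial function, $\operatorname{rank}(a)=|\operatorname{im}(a)|$; for a semigroup $T$, $\operatorname{rank}(T)$ is the least cardinality of a generating set (as a semigroup). $S(n,k)$ is the Stirling number of the second kind: the number of equivalence relations with exactly $k$ classes on a set of size $n$. *)

theory Defs
  imports "HOL-Combinatorics.Stirling" "HOL-Library.Disjoint_Sets"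
begin

section \<open>Generation and rank of semigroups\<close>

text \<open>A semigroup is given by its carrier set \<open>S\<close> and its binary operation \<open>m\<close>.\<close>

inductive_set subsemigroup_generated :: "('s \<Rightarrow> 's \<Rightarrow> 's) \<Rightarrow> 's set \<Rightarrow> 's set"
  for m :: "'s \<Rightarrow> 's \<Rightarrow> 's" and A :: "'s set"
  where
    gen: "f \<in> A \<Longrightarrow> f \<in> subsemigroup_generated m A"
  | mult: "f \<in> subsemigroup_generated m A \<Longrightarrow> g \<in> subsemigroup_generated m A
      \<Longrightarrow> m f g \<in> subsemigroup_generated m A"

definition generates :: "'s set \<Rightarrow> ('s \<Rightarrow> 's \<Rightarrow> 's) \<Rightarrow> 's set \<Rightarrow> bool"
  where "generates S m A \<longleftrightarrow> A \<subseteq> S \<and> subsemigroup_generated m A = S"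

text \<open>The value is meaningful only for finitely generated semigroups; the conjunct
  \<open>finite A\<close> prevents infinite generating sets, whose \<open>card\<close> is \<open>0\<close>, from being counted.\<close>

definition semigroup_rank :: "'s set \<Rightarrow> ('s \<Rightarrow> 's \<Rightarrow> 's) \<Rightarrow> nat"
  where "semigroup_rank S m = (LEAST n. \<exists>A. finite A \<and> generates S m A \<and> card A = n)"


section \<open>Partial functions and sandwich semigroups\<close>

definition partial_funs :: "'x set \<Rightarrow> 'y set \<Rightarrow> ('x \<rightharpoonup> 'y) set"
  where "partial_funs X Y = {f. dom f \<subseteq> X \<and> ran f \<subseteq> Y}"

definition pfun_rank :: "('x \<rightharpoonup> 'y) \<Rightarrow> nat"
  where "pfun_rank f = card (ran f)"

text \<open>Maps are composed from left to right in the source, so \<open>f a g\<close> means: first \<open>f\<close>,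
  then \<open>a\<close>, then \<open>g\<close>. The operator \<open>\<circ>\<^sub>m\<close> composes from right to left.\<close>

definition sandwich :: "('y \<rightharpoonup> 'x) \<Rightarrow> ('x \<rightharpoonup> 'y) \<Rightarrow> ('x \<rightharpoonup> 'y) \<Rightarrow> ('x \<rightharpoonup> 'y)"
  where "sandwich a f g = g \<circ>\<^sub>m (a \<circ>\<^sub>m f)"

lemma sandwich_closed:
  assumes "f \<in> partial_funs X Y" "g \<in> partial_funs X Y"
  shows "sandwich a f g \<in> partial_funs X Y"
proof -
  have "dom (sandwich a f g) \<subseteq> dom f"
    by (auto simp: sandwich_def map_comp_def split: option.splits)
  moreover have "ran (sandwich a f g) \<subseteq> ran g"
    by (auto simp: sandwich_def ran_def map_comp_def split: option.splits)
  ultimately show ?thesis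
    using assms unfolding partial_funs_def by blast
qed

lemma sandwich_assoc: "sandwich a (sandwich a f g) h = sandwich a f (sandwich a g h)"
  by (auto simp: sandwich_def map_comp_def fun_eq_iff split: option.splits)

lemma finite_partial_funs:
  assumes "finite X" "finite Y"
  shows "finite (partial_funs X Y)"
proof -
  have "finite {f :: 'a \<rightharpoonup> 'b. dom f = D \<and> ran f \<subseteq> Y}" if "D \<in> Pow X" for D
    using that assms by (intro finite_set_of_finite_maps) (auto intro: finite_subset)
  then have "finite (\<Union>D \<in> Pow X. {f :: 'a \<rightharpoonup> 'b. dom f = D \<and> ran f \<subseteq> Y})"
    using assms(1) by blast
  moreover have "partial_funs X Y = (\<Union>D \<in> Pow X. {f. dom f = D \<and> ran f \<subseteq> Y})"
    by (auto simp: partial_funs_def)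
  ultimately show ?thesis
    by simp
qed


section \<open>Stirling numbers count equivalence relations\<close>

text \<open>The library defines \<^const>\<open>Stirling\<close> by its recurrence. The lemma
  \<open>card_equiv_eq_Stirling\<close> below identifies it with the number of equivalence relations
  with exactly \<open>k\<close> classes.\<close>

lemma partitions_insert:
  assumes "x \<notin> A" "finite A"
  shows "{Q. partition_on (insert x A) Q \<and> card Q = Suc k} =
     insert {x} ` {P. partition_on A P \<and> card P = k} \<union>
     (\<lambda>(P, B). insert (insert x B) (P - {B})) ` (SIGMA P:{P. partition_on A P \<and> card P = Suc k}. P)"
    (is "?L = ?R1 \<union> ?R2")
proof (intro equalityI subsetI)
  fix Q assume "Q \<in> ?L"
  then have Q: "partition_on (insert x A) Q" "card Q = Suc k"
    by auto
  then have finQ: "finite Q"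
    by (simp add: card_ge_0_finite)
  obtain C where C: "C \<in> Q" "x \<in> C"
    using partition_onD1[OF Q(1)] by blast
  have Qd: "D \<inter> C = {}" if "D \<in> Q" "D \<noteq> C" for D
    using that C partition_onD2[OF Q(1)] by (auto simp: disjoint_def)
  have Ceq: "A = (C - {x}) \<union> \<Union>(Q - {C})"
  proof -
    have U: "\<Union>Q = C \<union> \<Union>(Q - {C})"
      using C(1) by auto
    have "x \<notin> \<Union>(Q - {C})"
      using C(2) Qd by blast
    moreover have "A = \<Union>Q - {x}"
      using partition_onD1[OF Q(1)] assms(1) by auto
    ultimately show ?thesis
      unfolding U by blast
  qed
  have dj: "disjoint (Q - {C})"
    using partition_onD2[OF Q(1)] by (auto simp: disjoint_def)
  have ne: "{} \<notin> Q"
    using partition_onD3[OF Q(1)] .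
  have cardQ: "card (Q - {C}) = k"
    using Q(2) C(1) finQ by simp
  show "Q \<in> ?R1 \<union> ?R2"
  proof (cases "C = {x}")
    case True
    then have "partition_on A (Q - {C})"
      using Ceq dj ne unfolding partition_on_def by auto
    moreover have "Q = insert {x} (Q - {C})"
      using True C(1) by auto
    ultimately show ?thesis
      using cardQ by blast
  next
    case False
    define B where "B = C - {x}"
    have B: "B \<noteq> {}" "insert x B = C"
      using False C(2) by (auto simp: B_def)
    have BQ: "B \<notin> Q - {C}"
      using Qd[of B] B(1) by (auto simp: B_def)
    define P where "P = insert B (Q - {C})"
    have "disjoint P"
      using dj Qd unfolding P_def B_def by (auto simp: disjoint_def)
    then have "partition_on A P"
      using Ceq ne B(1) unfolding partition_on_def P_def B_def by auto
    moreover have "card P = Suc k"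
      using BQ cardQ finQ by (simp add: P_def)
    moreover have "Q = insert (insert x B) (P - {B})"
      using B BQ C(1) by (auto simp: P_def)
    moreover have "B \<in> P"
      by (simp add: P_def)
    ultimately have "Q \<in> ?R2"
      by (intro image_eqI[of _ _ "(P, B)"]) auto
    then show ?thesis ..
  qed
next
  fix Q assume "Q \<in> ?R1 \<union> ?R2"
  then show "Q \<in> ?L"
  proof
    assume "Q \<in> ?R1"
    then obtain P where P: "partition_on A P" "card P = k" "Q = insert {x} P"
      by auto
    have "{x} \<notin> P"
      using partition_onD1[OF P(1)] assms(1) by auto
    moreover have "partition_on (insert x A) Q"
      using P assms(1) by (auto simp: partition_on_def disjoint_def)
    ultimately show ?thesis
      using P finite_elements[OF assms(2) P(1)] by auto
  next
    assume "Q \<in> ?R2"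
    then obtain P B where P: "partition_on A P" "card P = Suc k" "B \<in> P"
        "Q = insert (insert x B) (P - {B})"
      by auto
    have fin: "finite P"
      using finite_elements[OF assms(2) P(1)] .
    have notx: "D \<in> P \<Longrightarrow> x \<notin> D" for D
      using partition_onD1[OF P(1)] assms(1) by auto
    have d: "D \<inter> B = {}" if "D \<in> P" "D \<noteq> B" for D
      using that P(3) partition_onD2[OF P(1)] by (auto simp: disjoint_def)
    have "\<Union>Q = insert x A"
      using partition_onD1[OF P(1)] P(3,4) by auto
    moreover have "disjoint Q"
    proof -
      have "D \<inter> insert x B = {}" if "D \<in> P - {B}" for D
        using that d notx by auto
      moreover have "disjoint (P - {B})"
        using partition_onD2[OF P(1)] by (auto simp: disjoint_def)
      ultimately show ?thesis
        unfolding P(4) by (auto simp: pairwise_insert disjnt_def Int_commute)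
    qed
    moreover have "{} \<notin> Q"
      using partition_onD3[OF P(1)] P(4) by auto
    moreover have "card Q = Suc k"
    proof -
      have "insert x B \<notin> P - {B}"
        using notx by auto
      moreover have "card (P - {B}) = k"
        using P(2,3) fin by simp
      ultimately show ?thesis
        unfolding P(4) using fin by simp
    qed
    ultimately show ?thesis
      by (simp add: partition_on_def)
  qed
qed

lemma card_partitions_eq_Stirling:
  "finite A \<Longrightarrow> card {P. partition_on A P \<and> card P = k} = Stirling (card A) k"
proof (induction A arbitrary: k rule: finite_induct)
  case empty
  have "{P. partition_on {} P \<and> card P = k} = (if k = 0 then {{}} else {} :: 'a set set set)"
    by (auto simp: partition_on_empty)
  then show ?case
    by (cases k) (simp_all del: Collect_empty_eq)
next
  case (insert x A)
  show ?case
  proof (cases k)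
    case 0
    have "card P \<noteq> 0" if "partition_on (insert x A) P" for P
      using finite_elements[OF _ that] insert.hyps(1) partition_onD1[OF that]
      by (metis Union_empty card_0_eq empty_not_insert finite.insertI)
    then have none: "{P. partition_on (insert x A) P \<and> card P = k} = {}"
      using 0 by auto
    show ?thesis
      unfolding none using 0 insert.hyps by simp
  next
    case (Suc l)
    let ?P = "\<lambda>j. {P. partition_on A P \<and> card P = j}"
    let ?h = "\<lambda>(P, B). insert (insert x B) (P - {B})"
    have finP: "finite (?P j)" for j
      by (rule finite_subset[OF _ finitely_many_partition_on[OF insert.hyps(1)]]) auto
    have notx: "x \<notin> D" if "partition_on A P" "D \<in> P" for P D
      using partition_onD1[OF that(1)] that(2) insert.hyps(2) by auto
    have finE: "finite P" if "P \<in> ?P j" for P j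
      using that finite_elements[OF insert.hyps(1)] by auto
    have inj1: "inj_on (insert {x}) (?P l)"
    proof (rule inj_onI)
      fix P P' assume "P \<in> ?P l" "P' \<in> ?P l" and eq: "insert {x} P = insert {x} P'"
      then have "{x} \<notin> P" "{x} \<notin> P'"
        using notx by auto
      with eq show "P = P'"
        by (simp add: insert_ident)
    qed
    have inj2: "inj_on ?h (SIGMA P:?P (Suc l). P)"
    proof (rule inj_onI, clarify)
      fix P B P' B'
      assume P: "partition_on A P" "B \<in> P" and P': "partition_on A P'" "B' \<in> P'"
        and eq: "insert (insert x B) (P - {B}) = insert (insert x B') (P' - {B'})"
      have nx: "insert x B \<notin> P'" "insert x B \<notin> P" "insert x B' \<notin> P'" "x \<notin> B" "x \<notin> B'"
        using notx P P' by auto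
      then have "insert x B = insert x B'"
        using eq by blast
      then have B: "B = B'"
        using nx by (simp add: insert_ident)
      have "insert x B \<notin> P - {B}" "insert x B \<notin> P' - {B}"
        using nx by auto
      then have "P - {B} = P' - {B}"
        using eq unfolding B[symmetric] by (simp add: insert_ident)
      then show "P = P' \<and> B = B'"
        using B P(2) P'(2) by blast
    qed
    have disj: "insert {x} ` ?P l \<inter> ?h ` (SIGMA P:?P (Suc l). P) = {}"
    proof -
      have False if "partition_on A P" "partition_on A P'" "B \<in> P'"
        "insert {x} P = insert (insert x B) (P' - {B})" for P P' B
      proof -
        have "{x} \<notin> P' " "B \<noteq> {}" "x \<notin> B"
          using notx that partition_onD3[OF that(2)] by auto
        then have "{x} \<notin> insert (insert x B) (P' - {B})"
          by auto
        then show False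
          using that(4) by blast
      qed
      then show ?thesis
        by (auto simp: disjoint_iff)
    qed
    have finS: "finite (SIGMA P:?P (Suc l). P)"
      by (rule finite_SigmaI[OF finP]) (rule finE)
    have "card {Q. partition_on (insert x A) Q \<and> card Q = k} =
        card (insert {x} ` ?P l) + card (?h ` (SIGMA P:?P (Suc l). P))"
      unfolding Suc partitions_insert[OF insert.hyps(2,1)]
      by (rule card_Un_disjoint[OF finite_imageI[OF finP] finite_imageI[OF finS] disj])
    also have "\<dots> = card (?P l) + card (SIGMA P:?P (Suc l). P)"
      unfolding card_image[OF inj1] card_image[OF inj2] ..
    also have "card (SIGMA P:?P (Suc l). P) = (\<Sum>P\<in>?P (Suc l). card P)"
      by (rule card_SigmaI[OF finP]) (use finE in blast)
    also have "\<dots> = (\<Sum>P\<in>?P (Suc l). Suc l)"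
      by (rule sum.cong) auto
    also have "\<dots> = Suc l * card (?P (Suc l))"
      by (simp only: sum_constant mult.commute of_nat_id)
    also have "card (?P l) + \<dots> = Stirling (card A) l + Suc l * Stirling (card A) (Suc l)"
      by (simp only: insert.IH)
    finally show ?thesis
      using Suc insert.hyps by simp
  qed
qed

lemma card_equiv_eq_Stirling:
  assumes "finite A"
  shows "card {r. equiv A r \<and> card (A // r) = k} = Stirling (card A) k"
proof -
  have "bij_betw (\<lambda>r. A // r) {r. equiv A r \<and> card (A // r) = k}
          {P. partition_on A P \<and> card P = k}"
    unfolding bij_betw_def
  proof
    show "inj_on (\<lambda>r. A // r) {r. equiv A r \<and> card (A // r) = k}"
    proof (rule inj_onI, clarify)
      have rel: "r = {(x, y). \<exists>p \<in> A // r. x \<in> p \<and> y \<in> p}" if "equiv A r" for r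
      proof -
        have "\<exists>p \<in> A // r. x \<in> p \<and> y \<in> p" if "(x, y) \<in> r" for x y
        proof (rule bexI)
          have "x \<in> A"
            using \<open>equiv A r\<close> that by (auto simp: equiv_def)
          then show "x \<in> r `` {x} \<and> y \<in> r `` {x}" "r `` {x} \<in> A // r"
            using equiv_class_self[OF \<open>equiv A r\<close>] that by (auto intro: quotientI)
        qed
        moreover have "(x, y) \<in> r" if "p \<in> A // r" "x \<in> p" "y \<in> p" for p x y
          using in_quotient_imp_in_rel[OF \<open>equiv A r\<close> that(1)] that(2,3) by blast
        ultimately show ?thesis
          by auto
      qed
      fix r s assume "equiv A r" "equiv A s" "A // r = A // s"
      then show "r = s"
        using rel[of r] rel[of s] by simp
    qed
    show "(\<lambda>r. A // r) ` {r. equiv A r \<and> card (A // r) = k} = {P. partition_on A P \<and> card P = k}"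
      by (auto simp: partition_on_alt)
  qed
  then show ?thesis
    using card_partitions_eq_Stirling[OF assms, of k] by (simp only: bij_betw_same_card)
qed

end

theory Submission
  imports Defs "HOL-Combinatorics.Permutations"
begin

text \<open>
  The hypotheses say that \<open>a\<close> is injective and defined on all of \<open>Y\<close>. The kernel of a partial map
  is regarded as an equivalence on \<open>X\<close> with a point \<open>None\<close> adjoined, the class of \<open>None\<close>
  collecting the points where the map is undefined; the Stirling number thus counts the kernels
  of the maps onto \<open>Y\<close>. If \<open>f a g\<close> is onto \<open>Y\<close> then \<open>f\<close> is onto \<open>Y\<close> with the same
  kernel, so a generating set needs at least one map for every such kernel.

  Conversely, one well chosen map for every such kernel suffices. Since \<open>im a \<noteq> X\<close>, there
  is freedom enough for the chosen maps to include, for every \<open>y \<in> Y\<close>, some \<open>g\<close> such that \<open>a g\<close>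
  is the transposition of \<open>y\<close> with a chosen element of \<open>Y\<close>. These transpositions generate the symmetric
  group on \<open>Y\<close>, which gives all maps onto \<open>Y\<close>. A map \<open>f\<close> that misses \<open>y \<in> Y\<close> is reached
  by induction: redefine \<open>f\<close> to be \<open>y\<close> at a point \<open>x\<close> that is undefined or has the same value as
  another point, and send \<open>y\<close> back to \<open>f x\<close> with the second factor.
\<close>

section \<open>Kernels of partial maps\<close>

definition kernel :: "'x set \<Rightarrow> ('x \<rightharpoonup> 'y) \<Rightarrow> ('x option \<times> 'x option) set"
  where "kernel X f = {(u, v). u \<in> insert None (Some ` X) \<and> v \<in> insert None (Some ` X) \<and>
    Option.bind u f = Option.bind v f}"

definition onto_funs :: "'x set \<Rightarrow> 'y set \<Rightarrow> ('x \<rightharpoonup> 'y) set"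
  where "onto_funs X Y = {f \<in> partial_funs X Y. ran f = Y}"

lemma card_insert_None: "finite X \<Longrightarrow> card (insert None (Some ` X)) = card X + 1"
  by (subst card_insert_disjoint) (auto simp: card_image)

lemma partial_funs_iff: "f \<in> partial_funs X Y \<longleftrightarrow> (\<forall>x y. f x = Some y \<longrightarrow> x \<in> X \<and> y \<in> Y)"
  by (auto simp: partial_funs_def ran_def dom_def)

lemma onto_funs_iff:
  "f \<in> onto_funs X Y \<longleftrightarrow> (\<forall>x y. f x = Some y \<longrightarrow> x \<in> X \<and> y \<in> Y) \<and> (\<forall>y\<in>Y. \<exists>x\<in>X. f x = Some y)"
  unfolding onto_funs_def mem_Collect_eq partial_funs_iff ran_def by blast

text \<open>The value \<open>None\<close> is always attained, even when \<open>f\<close> is total on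
  \<open>X\<close>, because the adjoined point is sent there. This is the source of the
  \<open>+ 1\<close> in the counts below.\<close>

lemma bind_image:
  assumes "dom f \<subseteq> X"
  shows "(\<lambda>u. Option.bind u f) ` insert None (Some ` X) = insert None (Some ` ran f)"
proof -
  have "f x \<in> insert None (Some ` ran f)" for x
    by (cases "f x") (auto intro: ranI)
  then have "f ` X \<subseteq> insert None (Some ` ran f)"
    by (rule image_subsetI)
  moreover have "Some y \<in> f ` X" if y: "y \<in> ran f" for y
  proof -
    obtain x where "f x = Some y"
      using y by (auto simp: ran_def)
    then show ?thesis
      using assms by (metis domI image_eqI subsetD)
  qed
  then have "Some ` ran f \<subseteq> f ` X"
    by (rule image_subsetI)
  then have "insert None (Some ` ran f) \<subseteq> insert None (f ` X)"
    by (rule insert_mono)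
  ultimately have "insert None (f ` X) = insert None (Some ` ran f)"
    by (intro equalityI) (simp_all only: insert_subset insertI1 simp_thms)
  then show ?thesis
    by (simp add: image_image)
qed

lemma equiv_kernel: "equiv (insert None (Some ` X)) (kernel X f)"
proof -
  have "equiv A {(u, v). u \<in> A \<and> v \<in> A \<and> h u = h v}" for A :: "'c set" and h :: "'c \<Rightarrow> 'd"
    by (rule equivI) (auto simp: refl_on_def sym_def trans_def)
  then show ?thesis
    unfolding kernel_def .
qed

lemma kernel_eq_iff:
  fixes f :: "'x \<rightharpoonup> 'y" and g :: "'x \<rightharpoonup> 'z"
  shows "kernel X f = kernel X g \<longleftrightarrow>
    (\<forall>u \<in> insert None (Some ` X). \<forall>v \<in> insert None (Some ` X).
      Option.bind u f = Option.bind v f \<longleftrightarrow> Option.bind u g = Option.bind v g)"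
proof -
  have "{(u, v). u \<in> A \<and> v \<in> A \<and> P u v} = {(u, v). u \<in> A \<and> v \<in> A \<and> Q u v} \<longleftrightarrow>
      (\<forall>u\<in>A. \<forall>v\<in>A. P u v \<longleftrightarrow> Q u v)" for A :: "'c set" and P Q
    by auto
  then show ?thesis
    unfolding kernel_def .
qed

lemma card_quotient_kernel:
  assumes "finite Y" "f \<in> onto_funs X Y"
  shows "card (insert None (Some ` X) // kernel X f) = card Y + 1"
proof -
  let ?X = "insert None (Some ` X)"
  let ?F = "\<lambda>u. Option.bind u f"
  let ?c = "\<lambda>v. {u \<in> ?X. ?F u = v}"
  have "kernel X f `` {u} = ?c (?F u)" if "u \<in> ?X" for u
    using that unfolding kernel_def by auto
  then have "?X // kernel X f = (\<Union>u\<in>?X. {?c (?F u)})"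
    unfolding quotient_def by (intro SUP_cong refl) (simp only:)
  then have "?X // kernel X f = ?c ` ?F ` ?X"
    by (simp only: UNION_singleton_eq_range image_image)
  \<comment> \<open>Only attained values occur, so the fibres are nonempty and distinct values have
    distinct fibres.\<close>
  also have "card \<dots> = card (?F ` ?X)"
    by (intro card_image inj_onI) (smt (verit) imageE mem_Collect_eq)
  also have "?F ` ?X = insert None (Some ` Y)"
    using assms(2) by (subst bind_image) (auto simp: onto_funs_def partial_funs_def)
  finally show ?thesis
    unfolding card_insert_None[OF assms(1)] .
qed

text \<open>The class of \<open>None\<close> becomes the set where the map is undefined. The other
  classes are as many as the elements of \<open>Y\<close>, so any bijection \<open>h\<close> between
  them supplies the values.\<close>

lemma ex_onto_fun_with_kernel:
  assumes "finite X" "finite Y"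
    and "equiv (insert None (Some ` X)) r" "card (insert None (Some ` X) // r) = card Y + 1"
  shows "\<exists>f \<in> onto_funs X Y. kernel X f = r"
proof -
  let ?X = "insert None (Some ` X)"
  let ?Q = "?X // r - {r `` {None}}"
  have fin: "finite (?X // r)"
    using assms(4) by (metis Suc_eq_plus1 card.infinite nat.distinct(1))
  have cl: "r `` {u} \<in> ?X // r" if "u \<in> ?X" for u
    using that by (rule quotientI)
  have eq: "r `` {u} = r `` {v} \<longleftrightarrow> (u, v) \<in> r" if "u \<in> ?X" "v \<in> ?X" for u v
    using eq_equiv_class_iff[OF assms(3) that] .
  have "card ?Q = card Y"
    using assms(4) fin cl[of None] by simp
  then obtain h where h: "bij_betw h ?Q Y"
    using fin assms(2) finite_same_card_bij by blast
  define f where "f x = (if x \<in> X \<and> (None, Some x) \<notin> r then Some (h (r `` {Some x})) else None)" for x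
  have Q: "r `` {Some x} \<in> ?Q" if "x \<in> X" "(None, Some x) \<notin> r" for x
    using that cl[of "Some x"] eq[of None "Some x"] by auto
  have "f \<in> onto_funs X Y"
    unfolding onto_funs_iff
  proof (intro conjI allI impI ballI)
    fix x y assume "f x = Some y"
    then show "x \<in> X" "y \<in> Y"
      using bij_betwE[OF h] Q by (auto simp: f_def split: if_splits)
  next
    fix y assume "y \<in> Y"
    then obtain C where C: "C \<in> ?Q" "h C = y"
      using h by (metis bij_betw_imp_surj_on imageE)
    then obtain u where u: "u \<in> ?X" "C = r `` {u}"
      by (auto elim: quotientE)
    with C obtain x where x: "x \<in> X" "u = Some x"
      by auto
    then have "(None, Some x) \<notin> r"
      using C u eq[of None "Some x"] by auto
    then show "\<exists>x\<in>X. f x = Some y"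
      using C u x by (auto simp: f_def)
  qed
  moreover have "kernel X f = r"
  proof -
    have None: "(u, None) \<in> r \<longleftrightarrow> (None, u) \<in> r" "(None, None) \<in> r" for u
      using assms(3) by (auto simp: equiv_def sym_def refl_on_def)
    have tr: "(None, v) \<in> r" if "(None, u) \<in> r" "(u, v) \<in> r" for u v
      using that assms(3) by (auto simp: equiv_def trans_def)
    have sm: "(v, u) \<in> r" if "(u, v) \<in> r" for u v
      using that assms(3) by (auto simp: equiv_def sym_def)
    have tr2: "(u, v) \<in> r" if "(None, u) \<in> r" "(None, v) \<in> r" for u v
      using that assms(3) by (meson equiv_def sym_def trans_def)
    have F: "Option.bind u f = (if (None, u) \<in> r then None else Some (h (r `` {u})))"
      if "u \<in> ?X" for u
      using that None(2) by (auto simp: f_def)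
    have Q': "r `` {u} \<in> ?Q" if "u \<in> ?X" "(None, u) \<notin> r" for u
      using that Q None(2) by auto
    have "Option.bind u f = Option.bind v f \<longleftrightarrow> (u, v) \<in> r" if uv: "u \<in> ?X" "v \<in> ?X" for u v
    proof (cases "(None, u) \<in> r \<or> (None, v) \<in> r")
      case True
      then have "(u, v) \<in> r \<longleftrightarrow> (None, u) \<in> r \<and> (None, v) \<in> r"
        using tr[of u v] tr[of v u] sm[of u v] tr2[of u v] by blast
      then show ?thesis
        unfolding F[OF uv(1)] F[OF uv(2)] using True by auto
    next
      case False
      then have "Option.bind u f = Option.bind v f \<longleftrightarrow> r `` {u} = r `` {v}"
        unfolding F[OF uv(1)] F[OF uv(2)]
        using inj_on_eq_iff[OF bij_betw_imp_inj_on[OF h] Q'[OF uv(1)] Q'[OF uv(2)]] by simp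
      then show ?thesis
        using eq[OF uv] by simp
    qed
    moreover have "r \<subseteq> ?X \<times> ?X"
      using assms(3) by (rule equiv_type)
    ultimately show ?thesis
      unfolding kernel_def by blast
  qed
  ultimately show ?thesis
    by blast
qed

lemma card_kernels:
  assumes "finite X" "finite Y"
  shows "card (kernel X ` onto_funs X Y) = Stirling (card X + 1) (card Y + 1)"
proof -
  let ?X = "insert None (Some ` X)"
  have "kernel X ` onto_funs X Y = {r. equiv ?X r \<and> card (?X // r) = card Y + 1}"
    using ex_onto_fun_with_kernel[OF assms] equiv_kernel card_quotient_kernel[OF assms(2)] by blast
  moreover have "finite ?X"
    using assms by simp
  ultimately show ?thesis
    using card_equiv_eq_Stirling[of ?X "card Y + 1"] card_insert_None[OF assms(1)] by simp
qed

text \<open>Each of the two maps matches the classes other than that of \<open>None\<close> with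
  \<open>Y\<close>; \<open>p\<close> undoes the first matching and applies the second. Hence one
  onto map per kernel and the permutations of \<open>Y\<close> give all onto maps.\<close>

lemma kernel_eq_imp_permutes:
  assumes "finite Y" "f \<in> onto_funs X Y" "g \<in> onto_funs X Y" "kernel X f = kernel X g"
  shows "\<exists>p. p permutes Y \<and> g = map_option p \<circ> f"
proof -
  have ker: "f x = f x' \<longleftrightarrow> g x = g x'" if "x \<in> X" "x' \<in> X" for x x'
    using bspec[OF bspec[OF assms(4)[unfolded kernel_eq_iff], of "Some x"], of "Some x'"] that by simp
  have kerN: "f x = None \<longleftrightarrow> g x = None" if "x \<in> X" for x
    using bspec[OF bspec[OF assms(4)[unfolded kernel_eq_iff], of "Some x"], of "None"] that by simp
  have f: "\<And>x y. f x = Some y \<Longrightarrow> x \<in> X \<and> y \<in> Y" "\<And>y. y \<in> Y \<Longrightarrow> \<exists>x\<in>X. f x = Some y"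
    and g: "\<And>x y. g x = Some y \<Longrightarrow> x \<in> X \<and> y \<in> Y" "\<And>y. y \<in> Y \<Longrightarrow> \<exists>x\<in>X. g x = Some y"
    using assms(2,3) unfolding onto_funs_iff by blast+
  define s where "s y = (SOME x. x \<in> X \<and> f x = Some y)" for y
  have s: "s y \<in> X" "f (s y) = Some y" if "y \<in> Y" for y
    using someI_ex[of "\<lambda>x. x \<in> X \<and> f x = Some y"] f(2)[OF that] unfolding s_def by blast+
  \<comment> \<open>The section \<open>s\<close> of \<open>f\<close> picks a preimage to be sent
    through \<open>g\<close>. Outside \<open>Y\<close> the identity is forced by
    \<open>permutes\<close>.\<close>
  define p where "p y = (if y \<in> Y then the (g (s y)) else y)" for y
  have p: "g x = Some (p y)" if "f x = Some y" for x y
  proof -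
    have "x \<in> X" "y \<in> Y"
      using f(1) that by blast+
    then have "g x = g (s y)" "g x \<noteq> None"
      using ker[of x "s y"] kerN[of x] s that by auto
    then show ?thesis
      using \<open>y \<in> Y\<close> by (auto simp: p_def)
  qed
  have "Y \<subseteq> p ` Y"
  proof
    fix y assume "y \<in> Y"
    then obtain x where x: "x \<in> X" "g x = Some y"
      using g(2) by blast
    then obtain z where z: "f x = Some z"
      using kerN by fastforce
    then show "y \<in> p ` Y"
      using p[OF z] x f(1)[OF z] by auto
  qed
  moreover have "p ` Y \<subseteq> Y"
    using p s g(1) by blast
  ultimately have "bij_betw p Y Y"
    using finite_surj_inj[OF assms(1)] unfolding bij_betw_def by blast
  then have "p permutes Y"
    by (rule bij_imp_permutes) (simp add: p_def)
  moreover have "g x = map_option p (f x)" for x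
  proof (cases "f x")
    case None
    then show ?thesis
      using kerN[of x] g(1)[of x] by (cases "g x") auto
  qed (use p in auto)
  ultimately show ?thesis
    by (auto simp: fun_eq_iff)
qed

section \<open>The lower bound\<close>

lemma sandwich_apply: "sandwich a f g x = Option.bind (f x) (\<lambda>y. Option.bind (a y) g)"
  by (simp add: sandwich_def map_comp_def split: option.split)

text \<open>On pointed sets the product is \<open>f\<close> followed by the map \<open>P\<close> of
  \<open>a\<close> and then \<open>g\<close>. Since \<open>P\<close> sends the image of
  \<open>f\<close>, a subset of the finite set \<open>?Y\<close>, onto \<open>?Y\<close>, that image
  is all of \<open>?Y\<close> and \<open>P\<close> is injective on it. So \<open>f\<close> is onto,
  and \<open>P\<close> merges no classes.\<close>

lemma sandwich_onto_funsD:
  assumes "finite Y" "f \<in> partial_funs X Y" "g \<in> partial_funs X Y"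
    and "sandwich a f g \<in> onto_funs X Y"
  shows "f \<in> onto_funs X Y" "kernel X (sandwich a f g) = kernel X f"
proof -
  let ?X = "insert None (Some ` X)"
  let ?Y = "insert None (Some ` Y)"
  define P where "P u = Option.bind u (\<lambda>y. Option.bind (a y) g)" for u
  let ?F = "\<lambda>u. Option.bind u f"
  have PF: "Option.bind u (sandwich a f g) = P (?F u)" for u
    by (cases u) (simp_all add: P_def sandwich_apply)
  have F: "?F ` ?X = insert None (Some ` ran f)" "?F ` ?X \<subseteq> ?Y"
    using assms(2) bind_image[of f X] by (auto simp: partial_funs_def)
  have "?Y = (\<lambda>u. Option.bind u (sandwich a f g)) ` ?X"
    using assms(4) by (subst bind_image) (auto simp: onto_funs_def partial_funs_def)
  then have Y: "?Y = P ` ?F ` ?X"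
    unfolding PF image_image .
  have fin: "finite ?Y"
    using assms(1) by simp
  have eq: "?F ` ?X = ?Y"
    using fin F(2) Y by (metis card_image_le card_seteq finite_subset)
  then have "ran f = Y"
    unfolding F(1) by auto
  then show "f \<in> onto_funs X Y"
    using assms(2) by (simp add: onto_funs_def)
  have YP: "?Y = P ` ?Y"
    using Y unfolding eq .
  have inj: "inj_on P ?Y"
    by (rule finite_surj_inj[of ?Y P, OF fin equalityD1[OF YP]])
  have FY: "?F u \<in> ?Y" if "u \<in> ?X" for u
    using F(2) that unfolding image_subset_iff by (rule bspec)
  have "P (?F u) = P (?F v) \<longleftrightarrow> ?F u = ?F v" if "u \<in> ?X" "v \<in> ?X" for u v
    by (rule inj_on_eq_iff[OF inj FY[OF that(1)] FY[OF that(2)]])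
  then show "kernel X (sandwich a f g) = kernel X f"
    unfolding kernel_eq_iff PF by blast
qed

text \<open>An onto product inherits the kernel of its first factor, which is again onto, so the
  kernel can be traced back to a generator.\<close>

lemma generated_onto_fun_kernel:
  assumes "finite Y" "A \<subseteq> partial_funs X Y" "f \<in> subsemigroup_generated (sandwich a) A"
  shows "f \<in> partial_funs X Y \<and> (f \<in> onto_funs X Y \<longrightarrow> kernel X f \<in> kernel X ` A)"
  using assms(3)
proof induction
  case (gen f)
  then show ?case
    using assms(2) by blast
next
  case (mult f g)
  then show ?case
    using sandwich_closed[of f X Y g] sandwich_onto_funsD[OF assms(1), of f X g a] by auto
qed

lemma card_generates_ge:
  assumes "finite X" "finite Y" "finite A" "generates (partial_funs X Y) (sandwich a) A"
  shows "Stirling (card X + 1) (card Y + 1) \<le> card A"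
proof -
  have "kernel X ` onto_funs X Y \<subseteq> kernel X ` A"
    using generated_onto_fun_kernel[OF assms(2), of A X _ a] assms(4)
    by (auto simp: generates_def onto_funs_def)
  then have "card (kernel X ` onto_funs X Y) \<le> card (kernel X ` A)"
    using assms(3) by (intro card_mono) auto
  also have "\<dots> \<le> card A"
    using assms(3) by (rule card_image_le)
  finally show ?thesis
    by (simp only: card_kernels[OF assms(1,2)])
qed

section \<open>A generating set\<close>

text \<open>Choosing a preimage for each value of \<open>k\<close> missed by \<open>B\<close>
  completes \<open>B\<close>. This lets prescribed maps with distinct kernels belong to a minimal
  choice of one map per kernel.\<close>

lemma subset_transversal:
  assumes "B \<subseteq> S" "inj_on k B"
  shows "\<exists>A. B \<subseteq> A \<and> A \<subseteq> S \<and> bij_betw k A (k ` S)"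
proof -
  let ?A = "B \<union> inv_into S k ` (k ` S - k ` B)"
  have k: "k (inv_into S k z) = z" "inv_into S k z \<in> S" if "z \<in> k ` S" for z
    using f_inv_into_f[OF that] inv_into_into[OF that] .
  have new: "k ` inv_into S k ` (k ` S - k ` B) = k ` S - k ` B"
    using k(1) by (simp add: image_image)
  then have img: "k ` ?A = k ` S"
    using assms(1) by (auto simp only: image_Un)
  have "inj_on k (inv_into S k ` (k ` S - k ` B))"
    by (rule inj_on_inverseI[of _ "inv_into S k"]) (use k(1) in auto)
  moreover have "k ` B \<inter> k ` inv_into S k ` (k ` S - k ` B) = {}"
    unfolding new by blast
  ultimately have "inj_on k ?A"
    using assms(2) unfolding inj_on_Un by blast
  then have "bij_betw k ?A (k ` S)"
    using img by (simp only: bij_betw_def)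
  moreover have "?A \<subseteq> S"
    using assms(1) k(2) by blast
  ultimately show ?thesis
    by blast
qed

locale injective_sandwich =
  fixes X :: "'x set" and Y :: "'y set" and a :: "'y \<rightharpoonup> 'x" and b :: "'y \<Rightarrow> 'x" and x0 :: 'x
  assumes finite_X: "finite X" and finite_Y: "finite Y"
    and inj_b: "inj_on b Y" and b_into: "b ` Y \<subseteq> X"
    and a_eq: "\<And>y. y \<in> Y \<Longrightarrow> a y = Some (b y)"
    and x0: "x0 \<in> X" "x0 \<notin> b ` Y"
begin

text \<open>In the notation of the source, \<open>a (lift q v) = q\<close>; the point \<open>x0\<close> makes \<open>v\<close> a value.\<close>

definition lift :: "('y \<rightharpoonup> 'y) \<Rightarrow> 'y \<Rightarrow> ('x \<rightharpoonup> 'y)"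
  where "lift q v x = (if x \<in> b ` Y then q (inv_into Y b x) else if x = x0 then Some v else None)"

lemma lift_simps: "y \<in> Y \<Longrightarrow> lift q v (b y) = q y" "lift q v x0 = Some v"
  using x0 inj_b by (auto simp: lift_def)

lemma sandwich_lift:
  assumes "f \<in> partial_funs X Y"
  shows "sandwich a f (lift q v) x = Option.bind (f x) q"
  using assms by (cases "f x") (auto simp: sandwich_apply partial_funs_iff a_eq lift_simps)

text \<open>The map \<open>q\<close> may miss \<open>v\<close>, since \<open>x0\<close> takes that
  value.\<close>

lemma lift_onto:
  assumes "\<And>y z. y \<in> Y \<Longrightarrow> q y = Some z \<Longrightarrow> z \<in> Y" "v \<in> Y"
    and "\<And>z. z \<in> Y \<Longrightarrow> z \<noteq> v \<Longrightarrow> \<exists>y\<in>Y. q y = Some z"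
  shows "lift q v \<in> onto_funs X Y"
  unfolding onto_funs_iff
proof (intro conjI allI impI ballI)
  fix x y assume "lift q v x = Some y"
  then show "x \<in> X" "y \<in> Y"
    using assms(1,2) b_into x0 inj_b by (auto simp: lift_def split: if_splits)
next
  fix z assume z: "z \<in> Y"
  show "\<exists>x\<in>X. lift q v x = Some z"
  proof (cases "z = v")
    case True
    then show ?thesis
      using lift_simps(2) x0 by blast
  next
    case False
    then obtain y where "y \<in> Y" "q y = Some z"
      using assms(3) z by blast
    then show ?thesis
      using lift_simps(1) b_into by (metis image_subset_iff)
  qed
qed

definition star :: "'y \<Rightarrow> 'y \<Rightarrow> ('x \<rightharpoonup> 'y)"
  where "star y1 y = lift (Some \<circ> transpose y1 y) y1"

lemma star_onto:
  assumes "y1 \<in> Y" "y \<in> Y"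
  shows "star y1 y \<in> onto_funs X Y"
  unfolding star_def
proof (rule lift_onto)
  show "\<exists>u\<in>Y. (Some \<circ> transpose y1 y) u = Some z" if "z \<in> Y" for z
    using that assms by (intro bexI[of _ "transpose y1 y z"]) (auto simp: transpose_def)
qed (use assms in \<open>auto simp: transpose_def split: if_splits\<close>)

lemma inj_on_kernel_star:
  assumes "y1 \<in> Y"
  shows "inj_on (\<lambda>y. kernel X (star y1 y)) Y"
proof (rule inj_onI)
  fix y z assume yz: "y \<in> Y" "z \<in> Y" and eq: "kernel X (star y1 y) = kernel X (star y1 z)"
  have "b y \<in> X"
    using b_into yz by blast
  then have "star y1 y x0 = star y1 y (b y) \<longleftrightarrow> star y1 z x0 = star y1 z (b y)"
    using bspec[OF bspec[OF eq[unfolded kernel_eq_iff], of "Some x0"], of "Some (b y)"] x0 by simp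
  then have "transpose y1 z y = y1"
    using yz by (simp add: star_def lift_simps)
  then show "y = z"
    by (auto simp: transpose_def split: if_splits)
qed

lemma sandwich_star:
  assumes "f \<in> partial_funs X Y"
  shows "sandwich a f (star y1 y) = map_option (transpose y1 y) \<circ> f"
  using assms by (auto simp: fun_eq_iff star_def sandwich_lift map_conv_bind_option comp_def)

text \<open>Multiplying on the right by \<open>star y1 y\<close> applies the transposition of
  \<open>y1\<close> and \<open>y\<close> to the values, and every transposition of \<open>Y\<close>
  is a product of such ones.\<close>

lemma permute_generated:
  assumes "y1 \<in> Y" "star y1 ` Y \<subseteq> A" "A \<subseteq> partial_funs X Y" "p permutes Y"
    and "f \<in> subsemigroup_generated (sandwich a) A"
  shows "map_option p \<circ> f \<in> subsemigroup_generated (sandwich a) A"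
  using assms(4) finite_Y
proof (induction rule: permutes_induct)
  case id
  then show ?case
    using assms(5) by (simp only: option.map_id0 id_comp)
next
  case (swap c d p)
  let ?G = "subsemigroup_generated (sandwich a) A"
  have star: "map_option (transpose y1 y) \<circ> g \<in> ?G" if "y \<in> Y" "g \<in> ?G" for y g
  proof -
    have "sandwich a g (star y1 y) \<in> ?G"
      using that assms(2) by (auto intro: subsemigroup_generated.intros)
    moreover have "g \<in> partial_funs X Y"
      using generated_onto_fun_kernel[OF finite_Y assms(3) that(2)] by blast
    ultimately show ?thesis
      by (simp add: sandwich_star)
  qed
  have split: "map_option (p \<circ> q) \<circ> g = map_option p \<circ> (map_option q \<circ> g)"
    for p q :: "'y \<Rightarrow> 'y" and g :: "'x \<rightharpoonup> 'y"
    by (simp add: fun_eq_iff option.map_comp)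
  show ?case
  proof (cases "c = y1 \<or> d = y1")
    case True
    then obtain y where "y \<in> Y" "transpose c d = transpose y1 y"
      using swap.hyps transpose_commute by metis
    then show ?thesis
      using star[OF _ swap.IH] by (simp only: split)
  next
    case False
    \<comment> \<open>Conjugation by the transposition of \<open>y1\<close> and \<open>c\<close>
      turns the pair \<open>y1\<close>, \<open>d\<close> into \<open>c\<close>,
      \<open>d\<close>.\<close>
    then have "transpose c d = transpose y1 c \<circ> (transpose y1 d \<circ> transpose y1 c)"
      using swap.hyps by (auto simp: fun_eq_iff transpose_def)
    then show ?thesis
      using star swap.hyps swap.IH by (simp only: split)
  qed
qed

lemma generates_transversal:
  assumes "y1 \<in> Y" "star y1 ` Y \<subseteq> A" "A \<subseteq> onto_funs X Y" "kernel X ` A = kernel X ` onto_funs X Y"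
  shows "generates (partial_funs X Y) (sandwich a) A"
proof -
  let ?G = "subsemigroup_generated (sandwich a) A"
  have sub: "A \<subseteq> partial_funs X Y"
    using assms(3) by (auto simp: onto_funs_def)
  have onto: "f \<in> ?G" if f: "f \<in> onto_funs X Y" for f
  proof -
    obtain g where g: "g \<in> A" "kernel X g = kernel X f"
      using assms(4) f by (metis imageE image_eqI)
    then obtain p where "p permutes Y" "f = map_option p \<circ> g"
      using kernel_eq_imp_permutes[OF finite_Y, of g X f] f assms(3) by blast
    then show ?thesis
      using permute_generated[OF assms(1,2) sub] g(1) by (auto intro: subsemigroup_generated.gen)
  qed
  have "f \<in> ?G" if "f \<in> partial_funs X Y" for f
    using that
  proof (induction "card (Y - ran f)" arbitrary: f)
    case 0
    then have "ran f = Y"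
      using finite_Y by (auto simp: partial_funs_def)
    then show ?case
      using onto 0 by (simp add: onto_funs_def)
  next
    case (Suc n)
    then obtain y where y: "y \<in> Y" "y \<notin> ran f"
      by (metis Diff_iff card.empty equals0I nat.distinct(1))
    \<comment> \<open>Such a point \<open>x\<close> can be given the new value \<open>y\<close>
      without losing any old value.\<close>
    have "\<exists>x\<in>X. ran (f(x := None)) = ran f"
    proof (cases "X \<subseteq> dom f")
      case False
      then obtain x where "x \<in> X" "f x = None"
        by blast
      then show ?thesis
        by (metis fun_upd_triv)
    next
      case True
      \<comment> \<open>Pigeonhole: \<open>x0\<close> makes \<open>X\<close> larger than
        \<open>Y\<close>, so an \<open>f\<close> defined on all of \<open>X\<close> takes some value
        twice.\<close>
      have "card (b ` Y) < card X"
        using b_into x0 finite_X by (intro psubset_card_mono) auto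
      moreover have "(\<lambda>x. the (f x)) ` X \<subseteq> Y"
        using True Suc.prems by (auto simp: partial_funs_iff)
      ultimately have "\<not> inj_on (\<lambda>x. the (f x)) X"
        using card_inj_on_le[OF _ _ finite_Y] card_image[OF inj_b] by fastforce
      then obtain x x' where x: "x \<in> X" "x' \<in> X" "x \<noteq> x'" "f x = f x'"
        using True unfolding inj_on_def by (metis domIff option.expand subsetD)
      then have "f (if u = x then x' else u) = f u" for u
        by simp
      then have "ran (f(x := None)) = ran f"
        using x(3) by (auto simp: ran_def) metis
      then show ?thesis
        using x by blast
    qed
    then obtain x where x: "x \<in> X" "ran (f(x := None)) = ran f"
      by blast
    let ?f = "f(x := Some y)"
    let ?h = "lift (Some(y := f x)) y"
    have ran: "ran ?f = insert y (ran f)"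
      unfolding x(2)[symmetric] by (auto simp: ran_def)
    have f': "?f \<in> partial_funs X Y"
      using Suc.prems x y by (auto simp: partial_funs_iff)
    have "Y - ran ?f = (Y - ran f) - {y}"
      using ran by auto
    then have "n = card (Y - ran ?f)"
      using Suc.hyps(2) y finite_Y by simp
    then have "?f \<in> ?G"
      using Suc.hyps(1) f' by blast
    moreover have "?h \<in> ?G"
      using y Suc.prems by (intro onto lift_onto) (auto simp: partial_funs_iff split: if_splits)
    moreover have "sandwich a ?f ?h = f"
    proof
      fix u
      show "sandwich a ?f ?h u = f u"
        unfolding sandwich_lift[OF f'] using y by (cases "f u") (auto simp: ran_def)
    qed
    ultimately show ?case
      by (metis subsemigroup_generated.mult)
  qed
  then show ?thesis
    using sub generated_onto_fun_kernel[OF finite_Y sub] unfolding generates_def by blast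
qed

lemma ex_generating_set:
  assumes "Y \<noteq> {}"
  shows "\<exists>A. finite A \<and> generates (partial_funs X Y) (sandwich a) A \<and>
    card A = Stirling (card X + 1) (card Y + 1)"
proof -
  obtain y1 where y1: "y1 \<in> Y"
    using assms by blast
  have "star y1 ` Y \<subseteq> onto_funs X Y"
    using star_onto[OF y1] by blast
  moreover have "inj_on (kernel X) (star y1 ` Y)"
    using inj_on_kernel_star[OF y1] by (auto simp: inj_on_def)
  ultimately obtain A where A: "star y1 ` Y \<subseteq> A" "A \<subseteq> onto_funs X Y"
      "bij_betw (kernel X) A (kernel X ` onto_funs X Y)"
    using subset_transversal by metis
  have "finite (onto_funs X Y)"
    using finite_partial_funs[OF finite_X finite_Y] by (auto simp: onto_funs_def)
  then have "finite A"
    using A(2) finite_subset by blast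
  then show ?thesis
    using generates_transversal[OF y1 A(1,2)] bij_betw_imp_surj_on[OF A(3)]
      bij_betw_same_card[OF A(3)] card_kernels[OF finite_X finite_Y] by auto
qed

end

theorem theorem2p63:
  fixes X :: "'x set" and Y :: "'y set" and a :: "'y \<rightharpoonup> 'x" and \<alpha> :: nat
  assumes "finite X" and "finite Y"
    and "a \<in> partial_funs Y X"
    and "\<alpha> = pfun_rank a"
    and "1 \<le> \<alpha>"
    and "\<alpha> = card Y"
    and "card Y < card X"
  shows "semigroup_rank (partial_funs X Y) (sandwich a) = Stirling (card X + 1) (\<alpha> + 1)"
proof -
  let ?b = "\<lambda>y. the (a y)"
  have dom: "dom a \<subseteq> Y" "finite (dom a)"
    using assms(2,3) finite_subset by (auto simp: partial_funs_def)
  have ran: "ran a = ?b ` dom a"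
    by (force simp: ran_def dom_def image_iff)
  \<comment> \<open>The rank of \<open>a\<close> is at most the size of \<open>dom a\<close>, which
    lies in \<open>Y\<close>. Rank \<open>card Y\<close> therefore makes \<open>a\<close> total on
    \<open>Y\<close>, and then injective.\<close>
  then have "card Y \<le> card (?b ` dom a)"
    using assms(4,6) by (simp add: pfun_rank_def)
  also have "\<dots> \<le> card (dom a)"
    using dom(2) by (rule card_image_le)
  finally have dom_eq: "dom a = Y"
    using dom(1) assms(2) card_seteq by blast
  then have inj: "inj_on ?b Y"
    using ran assms(2,4,6) by (simp add: pfun_rank_def eq_card_imp_inj_on)
  have into: "?b ` Y \<subseteq> X"
    using ran assms(3) dom_eq by (simp add: partial_funs_def)
  obtain x0 where "x0 \<in> X" "x0 \<notin> ?b ` Y"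
    using assms(7) card_image[OF inj] into by (metis less_irrefl subsetI subset_antisym)
  then interpret injective_sandwich X Y a ?b x0
    using assms(1,2) inj into dom_eq by unfold_locales auto
  have "Y \<noteq> {}"
    using assms(5,6) by auto
  then show ?thesis
    unfolding semigroup_rank_def assms(6)
    using ex_generating_set card_generates_ge[OF assms(1,2)] by (intro Least_equality) blast+
qed

end
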